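(* There are arbitrarily large ordered matchings $\mathcal{M}_n$ on $n$ vertices such that \[\overline{R}(\mathcal{M}_n;2)\ge n^{\frac{\log n}{5\log\log n}}.\]
   Context: Logarithms are base 2. An ordered graph is a finite simple graph with a total ordering of its vertices; a copy of an ordered graph in another is given by an edge-preserving injection that preserves the orderings. An ordered matching is a graph whose edges are pairwise disjoint and cover all vertices (each vertex has degree exactly 1), together with a total ordering of its vertices. $\mathcal{K}_N$ is the complete graph on $N$ totally ordered vertices, and $\overline{R}(\mathcal{G};2)$ is the smallest $N$ such that every 2-coloring of the edges of $\mathcal{K}_N$ contains a monochromatic copy of $\mathcal{G}$. *)

theory Defs
  imports Complex_Main "HOL-Library.Ramsey" "HOL-Library.Disjoint_Sets"
begin

text \<open>A graph is given by its vertex set \<open>V\<close> and its edge set \<open>E\<close>, the edges being two-element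
  subsets of \<open>V\<close>. The total ordering of the vertices is the one induced by the linear order of the
  ambient type.\<close>

definition ordered_graph :: "'a::linorder set \<Rightarrow> 'a set set \<Rightarrow> bool" where
  "ordered_graph V E \<longleftrightarrow> finite V \<and> E \<subseteq> nsets V 2"

definition ordered_matching :: "'a::linorder set \<Rightarrow> 'a set set \<Rightarrow> bool" where
  "ordered_matching V E \<longleftrightarrow> ordered_graph V E \<and> disjoint E \<and> \<Union>E = V"

definition contains_copy ::
  "'b::linorder set \<Rightarrow> 'b set set \<Rightarrow> 'a::linorder set \<Rightarrow> 'a set set \<Rightarrow> bool" where
  "contains_copy W F V E \<longleftrightarrow>
     (\<exists>f. f ` V \<subseteq> W \<and> inj_on f V \<and> mono_on V f \<and> (\<forall>e\<in>E. f ` e \<in> F))"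

text \<open>The complete ordered graph on \<open>N\<close> vertices is \<open>({..<N}, nsets {..<N} 2)\<close>.\<close>

definition ordered_arrows :: "nat \<Rightarrow> 'a::linorder set \<Rightarrow> 'a set set \<Rightarrow> nat \<Rightarrow> bool" where
  "ordered_arrows N V E q \<longleftrightarrow>
     (\<forall>c \<in> nsets {..<N} 2 \<rightarrow> {..<q}. \<exists>i<q.
        contains_copy {..<N} {e \<in> nsets {..<N} 2. c e = i} V E)"

definition ordered_Ramsey :: "'a::linorder set \<Rightarrow> 'a set set \<Rightarrow> nat \<Rightarrow> nat" where
  "ordered_Ramsey V E q = (LEAST N. ordered_arrows N V E q)"

text \<open>For ordered graphs and at least one colour, the minimum is taken over a nonempty set, by
  Ramsey's theorem.\<close>

lemma ex_mono_inj:
  fixes V :: "'a::linorder set" and H :: "'b::linorder set"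
  assumes "finite V" "finite H" "card V = card H"
  shows "\<exists>f. f ` V = H \<and> inj_on f V \<and> mono_on V f"
  using assms
proof (induction V arbitrary: H rule: finite_linorder_max_induct)
  case empty
  then show ?case by auto
next
  case (insert b A)
  have bA: "b \<notin> A" using insert.hyps by auto
  have "H \<noteq> {}" using insert.prems insert.hyps bA by auto
  define m where "m = Max H"
  have m: "m \<in> H" using \<open>H \<noteq> {}\<close> insert.prems m_def by auto
  have "card A = card (H - {m})" using insert.prems insert.hyps bA m by simp
  then obtain f where f: "f ` A = H - {m}" "inj_on f A" "mono_on A f"
    using insert.IH[of "H - {m}"] insert.prems by auto
  define g where "g = f(b := m)"
  have gA: "g x = f x" if "x \<in> A" for x using that bA by (auto simp: g_def)
  have le: "f x \<le> m" if "x \<in> A" for x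
    using that f(1) insert.prems unfolding m_def by (intro Max_ge) auto
  have im: "g ` A = H - {m}" using gA f(1) by (metis image_cong)
  have 1: "g ` insert b A = H" using im m by (auto simp: g_def)
  have 2: "inj_on g (insert b A)"
    using insert.hyps(1) insert.prems by (intro eq_card_imp_inj_on) (simp, simp only: 1)
  have 3: "mono_on (insert b A) g"
  proof (rule mono_onI)
    fix r s assume rs: "r \<in> insert b A" "s \<in> insert b A" "r \<le> s"
    show "g r \<le> g s"
    proof (cases "s = b")
      case True
      then show ?thesis using rs le gA by (auto simp: g_def)
    next
      case False
      then have "s \<in> A" "r \<in> A" using rs insert.hyps by (auto simp: not_less[symmetric])
      then show ?thesis using gA f(3) rs(3) by (auto simp: mono_on_def)
    qed
  qed
  show ?case using 1 2 3 by blast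
qed

lemma ex_ordered_arrows:
  fixes V :: "'a::linorder set"
  assumes "ordered_graph V E" "q \<ge> 1"
  shows "\<exists>N. ordered_arrows N V E q"
proof -
  obtain N :: nat where N: "partn_lst {..<N} (replicate q (card V)) 2"
    using ramsey_full[of "replicate q (card V)" 2] by blast
  have "ordered_arrows N V E q"
    unfolding ordered_arrows_def
  proof
    fix c :: "nat set \<Rightarrow> nat" assume "c \<in> nsets {..<N} 2 \<rightarrow> {..<q}"
    then have "\<exists>i<q. monochromatic {..<N} (replicate q (card V) ! i) 2 c i"
      using N unfolding partn_lst_def by (metis length_replicate)
    then obtain i H where i: "i < q" and H: "H \<in> nsets {..<N} (card V)"
      and c: "c ` nsets H 2 \<subseteq> {i}"
      unfolding monochromatic_def by (metis nth_replicate)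
    have V: "finite V" and E: "E \<subseteq> nsets V 2" using assms by (auto simp: ordered_graph_def)
    have HN: "H \<subseteq> {..<N}" "finite H" "card H = card V" using H by (auto simp: nsets_def)
    obtain f where f: "f ` V = H" "inj_on f V" "mono_on V f"
      using ex_mono_inj[OF V HN(2)] HN(3) by auto
    have "f ` e \<in> nsets H 2" if "e \<in> E" for e
    proof -
      have e: "e \<subseteq> V" "finite e" "card e = 2" using that E by (auto simp: nsets_def)
      moreover have "card (f ` e) = card e"
        using e(1) f(2) by (intro card_image) (rule inj_on_subset)
      ultimately show ?thesis using f(1) by (auto simp: nsets_def)
    qed
    moreover have "nsets H 2 \<subseteq> nsets {..<N} 2" using HN(1) by (rule nsets_mono)
    ultimately have "\<forall>e\<in>E. f ` e \<in> {e \<in> nsets {..<N} 2. c e = i}"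
      using c by (simp add: image_subset_iff subset_iff)
    then have "contains_copy {..<N} {e \<in> nsets {..<N} 2. c e = i} V E"
      unfolding contains_copy_def using f HN(1) by metis
    then show "\<exists>i<q. contains_copy {..<N} {e \<in> nsets {..<N} 2. c e = i} V E"
      using i by blast
  qed
  then show ?thesis ..
qed

end

theory Submission
  imports Defs "HOL-Library.Product_Lexorder"
begin

text \<open>Let \<open>\<chi>\<close> be a 2-colouring of the edges of the complete graph on \<open>R\<close> vertices without monochromatic
  clique of size \<open>r\<close>, and let a 2-colouring on \<open>N\<close> vertices avoid monochromatic copies of a matching
  \<open>M\<close>. Colour \<open>R\<close> consecutive blocks of \<open>N\<close> vertices by \<open>\<chi>\<close> between blocks and by the second colouring
  inside each block. Let \<open>M'\<close> consist of \<open>r\<close> flanks with \<open>r - 1\<close> copies of \<open>M\<close> between them, each flank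
  made of \<open>R\<close> small intervals, such that any two small intervals of different flanks are joined by
  an edge. In an embedding of \<open>M'\<close>, the \<open>R - 1\<close> block boundaries cannot cut all the small intervals of
  a flank, so each flank has a small interval inside one block. If the embedding is monochromatic,
  these \<open>r\<close> blocks cannot all be distinct because of \<open>\<chi>\<close>, so two consecutive ones coincide and that
  block contains the copy of \<open>M\<close> in between, a contradiction.

  Thus \<open>N\<close> is multiplied by \<open>R\<close>, while \<open>n\<close> vertices become at most \<open>r (n + r R\<^sup>2)\<close>. With
  \<open>R = r\<^bsup>j/2\<^esup>\<close> in step \<open>j\<close> and \<open>K = r / log r\<close> steps, \<open>log n\<close> is about \<open>K log r = r\<close> and the logarithm of
  the number of vertices coloured is about \<open>(K\<^sup>2 / 4) log r\<close>, that is, \<open>(log n)\<^sup>2 / (4 log log n)\<close>.\<close>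

section \<open>Colourings without monochromatic cliques\<close>

lemma card_supersets:
  assumes "finite E" "A \<subseteq> E"
  shows "card {G. A \<subseteq> G \<and> G \<subseteq> E} = 2 ^ (card E - card A)"
proof -
  have "bij_betw (\<lambda>G. G - A) {G. A \<subseteq> G \<and> G \<subseteq> E} (Pow (E - A))"
    by (rule bij_betwI[where g = "\<lambda>G. G \<union> A"]) (use assms in auto)
  then have "card {G. A \<subseteq> G \<and> G \<subseteq> E} = card (Pow (E - A))"
    by (rule bij_betw_same_card)
  also have "\<dots> = 2 ^ (card E - card A)"
    using assms by (simp add: card_Pow card_Diff_subset finite_subset)
  finally show ?thesis .
qed

text \<open>Counting argument: a colouring is identified with the set \<open>G\<close> of edges of
  colour 1, and \<open>B H\<close> collects those constant on the edges within \<open>H\<close>.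
  There are at most \<open>R ^ r\<close> sets \<open>H\<close>, and each spoils at most a fraction
  \<open>2 / 2 ^ (r choose 2)\<close> of all colourings, so some \<open>G\<close> escapes every
  \<open>B H\<close>.\<close>

lemma ex_colouring_no_monochromatic:
  fixes r R :: nat
  assumes "2 * R ^ r < 2 ^ (r choose 2)"
  shows "\<exists>\<chi> \<in> nsets {..<R} 2 \<rightarrow> {..<2}. \<forall>i<2. \<not> monochromatic {..<R} r 2 \<chi> (i::nat)"
proof -
  define E where "E = nsets {..<R} 2"
  define K where "K = nsets {..<R} r"
  define B where "B H = {G. nsets H 2 \<subseteq> G \<and> G \<subseteq> E} \<union> Pow (E - nsets H 2)" for H
  have E: "finite E" by (simp add: E_def finite_imp_finite_nsets)
  have K: "finite K" by (simp add: K_def finite_imp_finite_nsets)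
  have cardB: "card (B H) * 2 ^ (r choose 2) \<le> 2 * 2 ^ card E" if "H \<in> K" for H
  proof -
    have H: "H \<subseteq> {..<R}" "card H = r" using that by (auto simp: K_def nsets_def)
    have sub: "nsets H 2 \<subseteq> E" using H unfolding E_def by (intro nsets_mono)
    have ch: "card (nsets H 2) = r choose 2" using H by simp
    have fin: "finite (nsets H 2)" using sub E by (rule finite_subset)
    have le: "r choose 2 \<le> card E" using card_mono[OF E sub] ch by simp
    have "card (B H) \<le> 2 ^ (card E - (r choose 2)) + card (Pow (E - nsets H 2))"
      unfolding B_def card_supersets[OF E sub, unfolded ch, symmetric] by (rule card_Un_le)
    also have "card (Pow (E - nsets H 2)) = 2 ^ (card E - (r choose 2))"
      using sub E fin ch by (simp add: card_Pow card_Diff_subset)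
    finally have "card (B H) * 2 ^ (r choose 2)
        \<le> 2 * (2 ^ (card E - (r choose 2)) * 2 ^ (r choose 2))"
      by simp
    then show ?thesis using le by (simp flip: power_add)
  qed
  have cK: "card K \<le> R ^ r"
    unfolding K_def using binomial_le_pow[of r R] by (cases "r \<le> R") (auto simp: binomial_eq_0)
  have "card (\<Union>H\<in>K. B H) * 2 ^ (r choose 2) \<le> (\<Sum>H\<in>K. card (B H)) * 2 ^ (r choose 2)"
    using card_UN_le[OF K] by simp
  also have "\<dots> \<le> (\<Sum>H\<in>K. 2 * 2 ^ card E)"
    unfolding sum_distrib_right by (intro sum_mono cardB)
  also have "\<dots> = 2 * card K * 2 ^ card E" by simp
  also have "\<dots> \<le> 2 * R ^ r * 2 ^ card E" using cK by simp
  also have "\<dots> < 2 ^ (r choose 2) * 2 ^ card E" using assms by simp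
  finally have "card (\<Union>H\<in>K. B H) < card (Pow E)" by (simp add: card_Pow E mult.commute)
  moreover have "finite (\<Union>H\<in>K. B H)"
    using K E by (auto simp: B_def intro: finite_subset[of _ "Pow E"])
  ultimately obtain G where G: "G \<subseteq> E" "\<And>H. H \<in> K \<Longrightarrow> G \<notin> B H"
    by (metis PowD UN_I card_mono not_less subsetI)
  define \<chi> :: "nat set \<Rightarrow> nat" where "\<chi> e = (if e \<in> G then 1 else 0)" for e
  have False if m: "i < 2" "monochromatic {..<R} r 2 \<chi> i" for i
  proof -
    obtain H where H: "H \<in> K" "\<chi> ` nsets H 2 \<subseteq> {i}"
      using m unfolding monochromatic_def K_def by blast
    have "i = 0 \<or> i = 1" using m by auto
    then have "nsets H 2 \<subseteq> G \<or> G \<subseteq> E - nsets H 2"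
      using H(2) G(1) by (auto simp: \<chi>_def image_subset_iff split: if_splits)
    then show False using G H(1) by (auto simp: B_def)
  qed
  then show ?thesis by (intro bexI[of _ \<chi>]) (auto simp: \<chi>_def)
qed

section \<open>Transfer to the natural numbers\<close>

lemma contains_copy_image:
  assumes f: "inj_on f V" "mono_on V f" and E: "\<And>e. e \<in> E \<Longrightarrow> e \<subseteq> V"
    and "contains_copy W F (f ` V) ((`) f ` E)"
  shows "contains_copy W F V E"
proof -
  obtain g where g: "g ` f ` V \<subseteq> W" "inj_on g (f ` V)" "mono_on (f ` V) g"
      "\<forall>e\<in>(`) f ` E. g ` e \<in> F"
    using assms(4) unfolding contains_copy_def by (elim exE conjE)
  have "mono_on V (g \<circ> f)"
    using f(2) g(3) by (auto simp: mono_on_def)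
  moreover have "inj_on (g \<circ> f) V" using f g by (simp add: comp_inj_on)
  ultimately show ?thesis using g unfolding contains_copy_def
    by (intro exI[of _ "g \<circ> f"]) (auto simp: image_comp)
qed

text \<open>The interleaving takes a matching on naturals to one on quadruples. Relabelling the
  result by an order-preserving injection allows the construction to be iterated.\<close>

lemma ordered_matching_to_nat:
  fixes V :: "'a::linorder set"
  assumes "ordered_matching V E"
  obtains V' :: "nat set" and E' where "ordered_matching V' E'" "card V' = card V"
    "\<And>N q. ordered_arrows N V' E' q \<Longrightarrow> ordered_arrows N V E q"
proof -
  have V: "finite V" "E \<subseteq> nsets V 2" "disjoint E" "\<Union>E = V"
    using assms by (auto simp: ordered_matching_def ordered_graph_def)
  obtain f where f: "f ` V = {..<card V}" "inj_on f V" "mono_on V f"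
    using ex_mono_inj[OF V(1), of "{..<card V}"] by auto
  have "ordered_matching (f ` V) ((`) f ` E)"
    unfolding ordered_matching_def ordered_graph_def
  proof (intro conjI)
    show "(`) f ` E \<subseteq> nsets (f ` V) 2"
    proof clarify
      fix e assume "e \<in> E"
      then have "e \<subseteq> V" "finite e" "card e = 2" using V by (auto simp: nsets_def)
      then show "f ` e \<in> nsets (f ` V) 2"
        using f(2) by (auto simp: nsets_def card_image inj_on_subset)
    qed
    show "disjoint ((`) f ` E)"
    proof (rule disjointI)
      fix a b assume "a \<in> (`) f ` E" "b \<in> (`) f ` E" "a \<noteq> b"
      then obtain a' b' where ab: "a' \<in> E" "b' \<in> E" "a = f ` a'" "b = f ` b'" "a' \<noteq> b'" by auto
      then have "a' \<inter> b' = {}" "a' \<subseteq> V" "b' \<subseteq> V" using V by (auto dest: disjointD)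
      then show "a \<inter> b = {}" using f(2) ab inj_on_image_Int[of f V a' b'] by simp
    qed
  qed (use V in auto)
  moreover have "card (f ` V) = card V" using f by (simp add: card_image)
  moreover have "ordered_arrows N V E q" if "ordered_arrows N (f ` V) ((`) f ` E) q" for N q
    using that contains_copy_image[OF f(2,3), of E] V(4) unfolding ordered_arrows_def by blast
  ultimately show thesis by (rule that)
qed

section \<open>Interleaving copies of a matching with flanks\<close>

text \<open>The flank \<open>i\<close> consists of the vertices \<open>(2 * i + 1, a, j, b)\<close>, and those with a given \<open>a\<close> form
  its \<open>a\<close>-th small interval; the last two entries name the small interval where the partner lies.
  The lexicographic order puts the copy \<open>i\<close> between the flanks \<open>i - 1\<close> and \<open>i\<close>.\<close>

type_synonym vertex = "nat \<times> nat \<times> nat \<times> nat"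

definition flank_vertices :: "nat \<Rightarrow> nat \<Rightarrow> vertex set" where
  "flank_vertices r R = {(2 * i + 1, a, j, b) | i a j b. i < r \<and> j < r \<and> i \<noteq> j \<and> a < R \<and> b < R}"

definition flank_edges :: "nat \<Rightarrow> nat \<Rightarrow> vertex set set" where
  "flank_edges r R = {{(2 * i + 1, a, j, b), (2 * j + 1, b, i, a)} | i a j b.
     i < r \<and> j < r \<and> i \<noteq> j \<and> a < R \<and> b < R}"

definition copy_vertex :: "nat \<Rightarrow> nat \<Rightarrow> vertex" where
  "copy_vertex i v = (2 * i, v, 0, 0)"

definition interleaved_vertices :: "nat \<Rightarrow> nat \<Rightarrow> nat set \<Rightarrow> vertex set" where
  "interleaved_vertices r R V = flank_vertices r R \<union> (\<Union>i\<in>{1..<r}. copy_vertex i ` V)"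

definition interleaved_edges :: "nat \<Rightarrow> nat \<Rightarrow> nat set set \<Rightarrow> vertex set set" where
  "interleaved_edges r R E = flank_edges r R \<union> (\<Union>i\<in>{1..<r}. (`) (copy_vertex i) ` E)"

lemma inj_copy_vertex: "inj_on (copy_vertex i) A"
  by (auto simp: inj_on_def copy_vertex_def)

lemma flank_vertices_subset:
  "flank_vertices r R \<subseteq> (\<lambda>(i, a, j, b). (2 * i + 1, a, j, b)) ` ({..<r} \<times> {..<R} \<times> {..<r} \<times> {..<R})"
  by (force simp: flank_vertices_def)

lemma finite_flank_vertices: "finite (flank_vertices r R)"
  by (rule finite_subset[OF flank_vertices_subset]) simp

lemma card_flank_vertices: "card (flank_vertices r R) \<le> r * (r * R\<^sup>2)"
proof -
  have "card (flank_vertices r R) \<le> card ({..<r} \<times> {..<R} \<times> {..<r} \<times> {..<R})"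
    by (rule surj_card_le[OF _ flank_vertices_subset]) simp
  then show ?thesis by (simp add: card_cartesian_product power2_eq_square algebra_simps)
qed

lemma card_copies:
  assumes "finite V"
  shows "card (\<Union>i\<in>{1..<r}. copy_vertex i ` V) = (r - 1) * card V"
proof -
  have "card (\<Union>i\<in>{1..<r}. copy_vertex i ` V) = (\<Sum>i\<in>{1..<r}. card (copy_vertex i ` V))"
    using assms by (intro card_UN_disjoint) (auto simp: copy_vertex_def)
  then show ?thesis by (simp add: card_image inj_copy_vertex)
qed

lemma card_interleaved_le:
  assumes "finite V"
  shows "card (interleaved_vertices r R V) \<le> r * (card V + r * R\<^sup>2)"
proof -
  have "card (interleaved_vertices r R V) \<le> r * (r * R\<^sup>2) + (r - 1) * card V"
    unfolding interleaved_vertices_def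
    by (rule order_trans[OF card_Un_le])
       (use card_copies[OF assms, of r] card_flank_vertices[of r R] in linarith)
  also have "\<dots> \<le> r * (r * R\<^sup>2) + r * card V" by simp
  finally show ?thesis by (simp add: algebra_simps)
qed

text \<open>Besides making the matchings arbitrarily large, a lower bound on \<open>n\<close> is
  needed because \<open>log (log n)\<close> stands in the denominator of the target
  exponent.\<close>

lemma card_interleaved_ge:
  assumes "finite V"
  shows "(r - 1) * card V \<le> card (interleaved_vertices r R V)"
  unfolding card_copies[OF assms, symmetric] interleaved_vertices_def
  by (rule card_mono) (auto simp: assms finite_flank_vertices)

text \<open>A flank vertex determines its partner, since the two name each other's flank and small
  interval. The parity of the first entry separates flanks from copies, and its value separates the
  copies from each other.\<close>

lemma ordered_matching_interleaved:
  assumes "ordered_matching V E"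
  shows "ordered_matching (interleaved_vertices r R V) (interleaved_edges r R E)"
proof -
  have V: "finite V" "E \<subseteq> nsets V 2" "disjoint E" "\<Union>E = V"
    using assms by (auto simp: ordered_matching_def ordered_graph_def)
  have "\<Union>(flank_edges r R) = flank_vertices r R"
    unfolding flank_edges_def flank_vertices_def by (auto; metis insertCI)
  moreover have "\<Union>(\<Union>i\<in>{1..<r}. (`) (copy_vertex i) ` E) = (\<Union>i\<in>{1..<r}. copy_vertex i ` V)"
    using V(4) by blast
  ultimately have un: "\<Union>(interleaved_edges r R E) = interleaved_vertices r R V"
    unfolding interleaved_edges_def interleaved_vertices_def by (simp only: Union_Un_distrib)
  have two: "card e = 2" "finite e" if "e \<in> interleaved_edges r R E" for e
  proof -
    have "card e = 2"
      using that V(2) unfolding interleaved_edges_def flank_edges_def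
      by (auto simp: card_image inj_copy_vertex nsets_def)
    then show "card e = 2" "finite e" by (auto intro: card_ge_0_finite)
  qed
  have "disjoint (interleaved_edges r R E)"
  proof (rule disjointI)
    fix e e' assume *: "e \<in> interleaved_edges r R E" "e' \<in> interleaved_edges r R E" "e \<noteq> e'"
    have ff: "e \<inter> e' = {}" if "e \<in> flank_edges r R" "e' \<in> flank_edges r R"
      using that * unfolding flank_edges_def by (auto simp: doubleton_eq_iff)
    have fc: "e \<inter> e' = {}" if "e \<in> flank_edges r R" "e' = copy_vertex i ` d" for e e' i d
      using that unfolding flank_edges_def by (auto simp: copy_vertex_def; presburger)
    have cc: "e \<inter> e' = {}"
      if "e = copy_vertex i ` d" "e' = copy_vertex i' ` d'" "d \<in> E" "d' \<in> E" for i i' d d'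
    proof (cases "i = i'")
      case True
      then have "d \<inter> d' = {}" using that * V(3) by (auto dest: disjointD)
      then show ?thesis using that True by (auto simp: copy_vertex_def)
    next
      case False
      then show ?thesis using that by (auto simp: copy_vertex_def)
    qed
    show "e \<inter> e' = {}"
      using * ff fc[of e e'] fc[of e' e] cc unfolding interleaved_edges_def by blast
  qed
  moreover have "interleaved_edges r R E \<subseteq> nsets (interleaved_vertices r R V) 2"
    using two un unfolding nsets_def by blast
  moreover have "finite (interleaved_vertices r R V)"
    unfolding interleaved_vertices_def using V(1) finite_flank_vertices by auto
  ultimately show ?thesis using un by (simp add: ordered_matching_def ordered_graph_def)
qed

section \<open>The product colouring avoids the interleaved matching\<close>

lemma not_ordered_arrows_interleaved:
  assumes \<chi>: "\<chi> \<in> nsets {..<R} 2 \<rightarrow> {..<2}" "\<forall>i<2. \<not> monochromatic {..<R} r 2 \<chi> (i::nat)"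
    and V: "ordered_matching V E" "\<not> ordered_arrows N V E 2"
    and pos: "r \<ge> 2" "R > 0" "N > 0"
  shows "\<not> ordered_arrows (R * N) (interleaved_vertices r R V) (interleaved_edges r R E) 2"
proof
  assume arrows: "ordered_arrows (R * N) (interleaved_vertices r R V) (interleaved_edges r R E) 2"
  let ?V = "interleaved_vertices r R V" and ?E = "interleaved_edges r R E"
  have VE: "\<Union>E = V" "E \<subseteq> nsets V 2" using V(1) by (auto simp: ordered_matching_def ordered_graph_def)
  obtain c :: "nat set \<Rightarrow> nat" where c: "c \<in> nsets {..<N} 2 \<rightarrow> {..<2}"
    and nocopy: "\<And>i. i < 2 \<Longrightarrow> \<not> contains_copy {..<N} {e \<in> nsets {..<N} 2. c e = i} V E"
    using V(2) unfolding ordered_arrows_def by blast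
  define blk where "blk x = x div N" for x
  define pos where "pos x = x mod N" for x
  \<comment> \<open>Cardinality 1 of the image encodes that both ends of the edge lie in one block,
    so every block carries its own copy of \<open>c\<close>.\<close>
  define c' where "c' e = (if card (blk ` e) = 1 then c (pos ` e) else \<chi> (blk ` e))" for e
  have eq: "x = y" if "blk x = blk y" "pos x = pos y" for x y
    using that unfolding blk_def pos_def by (metis div_mult_mod_eq)
  have pos_mono: "pos x \<le> pos y" if "blk x = blk y" "x \<le> y" for x y
    using that unfolding blk_def pos_def by (metis add_le_cancel_left div_mult_mod_eq)
  have blk_less: "blk x < R" if "x < R * N" for x
    using that by (simp add: blk_def less_mult_imp_div_less)
  have pos_less: "pos x < N" for x using \<open>N > 0\<close> by (simp add: pos_def)
  have "c' \<in> nsets {..<R * N} 2 \<rightarrow> {..<2}"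
  proof
    fix e assume "e \<in> nsets {..<R * N} 2"
    then obtain x y where e: "e = {x, y}" "x < R * N" "y < R * N" "x \<noteq> y"
      by (auto elim: nsets2_E)
    show "c' e \<in> {..<2}"
    proof (cases "blk x = blk y")
      case True
      then have "pos x \<noteq> pos y" using e eq by blast
      then have "pos ` e \<in> nsets {..<N} 2" using e pos_less by simp
      then show ?thesis using c True e by (auto simp: c'_def)
    next
      case False
      then have "blk ` e \<in> nsets {..<R} 2" using e blk_less by simp
      then show ?thesis using \<chi>(1) False e by (auto simp: c'_def)
    qed
  qed
  then obtain col where col: "col < 2"
    and copy: "contains_copy {..<R * N} {e \<in> nsets {..<R * N} 2. c' e = col} ?V ?E"
    using arrows unfolding ordered_arrows_def by blast
  obtain g where g: "g ` ?V \<subseteq> {..<R * N}" "inj_on g ?V" "mono_on ?V g"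
    and "\<forall>e\<in>?E. g ` e \<in> {e \<in> nsets {..<R * N} 2. c' e = col}"
    using copy unfolding contains_copy_def by (elim exE conjE)
  then have ge: "c' (g ` e) = col" if "e \<in> ?E" for e using that by simp
  define S :: "nat \<Rightarrow> nat \<Rightarrow> vertex set"
    where "S i a = {(2 * i + 1, a, j, b) | j b. j < r \<and> i \<noteq> j \<and> b < R}" for i a
  have SV: "u \<in> ?V" if "u \<in> S i a" "i < r" "a < R" for u i a
    using that by (auto simp: S_def interleaved_vertices_def flank_vertices_def)
  have CV: "copy_vertex i v \<in> ?V" if "v \<in> V" "i \<in> {1..<r}" for i v
    using that by (auto simp: interleaved_vertices_def)
  have blk_mono: "blk (g u) \<le> blk (g v)" if "u \<in> ?V" "v \<in> ?V" "u \<le> v" for u v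
    unfolding blk_def using mono_onD[OF g(3) that] by (rule div_le_mono)
  have S_ne: "\<exists>u. u \<in> S i a" for i a
  proof -
    have "(2 * i + 1, a, if i = 0 then 1 else 0, 0) \<in> S i a"
      using \<open>r \<ge> 2\<close> \<open>R > 0\<close> by (auto simp: S_def)
    then show ?thesis by blast
  qed
  have "\<exists>a<R. \<exists>b. \<forall>u\<in>S i a. blk (g u) = b" if "i < r" for i
  proof (rule ccontr)
    assume "\<not> (\<exists>a<R. \<exists>b. \<forall>u\<in>S i a. blk (g u) = b)"
    then have "\<exists>u\<in>S i a. \<exists>v\<in>S i a. blk (g u) \<noteq> blk (g v)" if "a < R" for a using that by blast
    then have split: "\<exists>u\<in>S i a. \<exists>v\<in>S i a. blk (g u) < blk (g v)" if "a < R" for a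
      using that by (metis linorder_neqE_nat)
    \<comment> \<open>If every small interval of the flank met two blocks, each would push the block
      number up by at least one. After all \<open>R\<close> intervals it would exceed
      \<open>R - 1\<close>, the last block.\<close>
    have "\<exists>v\<in>S i a. a < blk (g v)" if "a < R" for a
      using that
    proof (induction a)
      case 0
      then obtain u v where "u \<in> S i 0" "v \<in> S i 0" "blk (g u) < blk (g v)"
        using split by blast
      then show ?case by (intro bexI[of _ v]) auto
    next
      case (Suc a)
      then obtain w where w: "w \<in> S i a" "a < blk (g w)" by auto
      obtain u v where uv: "u \<in> S i (Suc a)" "v \<in> S i (Suc a)" "blk (g u) < blk (g v)"
        using split[OF Suc.prems] by blast
      have "w \<le> u" using w uv by (auto simp: S_def)
      then have "blk (g w) \<le> blk (g u)" using blk_mono SV w uv \<open>i < r\<close> Suc.prems by (meson Suc_lessD)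
      then show ?case using uv w by (intro bexI[of _ v]) auto
    qed
    from this[of "R - 1"] obtain v where v: "v \<in> S i (R - 1)" "R - 1 < blk (g v)"
      using \<open>R > 0\<close> by auto
    have "v \<in> ?V" using SV[OF v(1) \<open>i < r\<close>] \<open>R > 0\<close> by simp
    then have "g v < R * N" using g(1) by blast
    then show False using blk_less[of "g v"] v(2) by linarith
  qed
  then obtain A b where A: "\<And>i. i < r \<Longrightarrow> A i < R"
    and b: "\<And>i u. i < r \<Longrightarrow> u \<in> S i (A i) \<Longrightarrow> blk (g u) = b i"
    by metis
  have b_less: "b i < R" if "i < r" for i
  proof -
    obtain u where u: "u \<in> S i (A i)" using S_ne by blast
    then have "g u < R * N" using SV[OF u that A[OF that]] g(1) by blast
    then show ?thesis using blk_less[of "g u"] b[OF that u] by simp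
  qed
  \<comment> \<open>Copy \<open>Suc i\<close> lies between the flanks \<open>i\<close> and
    \<open>Suc i\<close>, so its block numbers are squeezed between \<open>b i\<close> and
    \<open>b (Suc i)\<close>. Without strict growth it falls into the single block
    \<open>b i\<close>, where \<open>c\<close> forbids it.\<close>
  have step: "b i < b (Suc i)" if i: "Suc i < r" for i
  proof (rule ccontr)
    assume nless: "\<not> b i < b (Suc i)"
    let ?h = "\<lambda>v. g (copy_vertex (Suc i) v)"
    have blk_h: "blk (?h v) = b i" if "v \<in> V" for v
    proof -
      obtain u w where u: "u \<in> S i (A i)" and w: "w \<in> S (Suc i) (A (Suc i))" using S_ne by blast
      have "u \<le> copy_vertex (Suc i) v" "copy_vertex (Suc i) v \<le> w"
        using u w by (auto simp: S_def copy_vertex_def)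
      then have "blk (g u) \<le> blk (?h v)" "blk (?h v) \<le> blk (g w)"
        using blk_mono SV[OF u] SV[OF w] A CV[OF \<open>v \<in> V\<close>, of "Suc i"] i by auto
      then show ?thesis using b[OF _ u] b[OF _ w] i nless by auto
    qed
    have h_inj: "v = w" if "v \<in> V" "w \<in> V" "?h v = ?h w" for v w
    proof -
      have "copy_vertex (Suc i) v = copy_vertex (Suc i) w"
        using that i by (intro inj_onD[OF g(2)] CV) auto
      then show ?thesis by (simp add: copy_vertex_def)
    qed
    have h_mono: "?h v \<le> ?h w" if "v \<in> V" "w \<in> V" "v \<le> w" for v w
      using that i by (intro mono_onD[OF g(3)] CV) (auto simp: copy_vertex_def)
    have pos_inj: "inj_on (pos \<circ> ?h) V"
      using h_inj blk_h eq by (auto simp: inj_on_def)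
    have "contains_copy {..<N} {e \<in> nsets {..<N} 2. c e = col} V E"
      unfolding contains_copy_def
    proof (intro exI[of _ "pos \<circ> ?h"] conjI ballI)
      show "(pos \<circ> ?h) ` V \<subseteq> {..<N}" using pos_less by auto
      show "inj_on (pos \<circ> ?h) V" by (fact pos_inj)
      show "mono_on V (pos \<circ> ?h)"
      proof (rule mono_onI)
        fix v w assume vw: "v \<in> V" "w \<in> V" "v \<le> w"
        then have "blk (?h v) = blk (?h w)" using blk_h by simp
        then show "(pos \<circ> ?h) v \<le> (pos \<circ> ?h) w"
          using h_mono[OF vw] pos_mono by simp
      qed
      fix e assume e: "e \<in> E"
      then have eV: "e \<subseteq> V" "finite e" "card e = 2" using VE by (auto simp: nsets_def)
      have "(pos \<circ> ?h) ` e \<in> nsets {..<N} 2"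
        using eV pos_less card_image[OF inj_on_subset[OF pos_inj eV(1)]] by (auto simp: nsets_def)
      moreover have "c ((pos \<circ> ?h) ` e) = col"
      proof -
        have "copy_vertex (Suc i) ` e \<in> ?E"
          using e i unfolding interleaved_edges_def by (intro UnI2 UN_I[of "Suc i"]) auto
        then have "c' (g ` copy_vertex (Suc i) ` e) = col" by (rule ge)
        moreover have "blk ` g ` copy_vertex (Suc i) ` e = {b i}"
        proof -
          have "e \<noteq> {}" using eV by auto
          moreover have "(\<lambda>v. blk (?h v)) ` e = (\<lambda>_. b i) ` e"
            using blk_h eV(1) by (intro image_cong) auto
          ultimately show ?thesis by (simp add: image_image image_constant_conv)
        qed
        ultimately show ?thesis by (simp add: c'_def image_comp comp_assoc[symmetric] comp_def)
      qed
      ultimately show "(pos \<circ> ?h) ` e \<in> {e \<in> nsets {..<N} 2. c e = col}" by simp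
    qed
    then show False using nocopy col by blast
  qed
  have b_mono: "b i < b j" if "i < j" "j < r" for i j
    using that
  proof (induction j)
    case (Suc j)
    then show ?case using step[of j] by (cases "i = j") auto
  qed simp
  have b_inj: "inj_on b {..<r}"
    using b_mono by (intro inj_onI) (metis lessThan_iff less_irrefl linorder_neqE_nat)
  have "\<chi> ` nsets (b ` {..<r}) 2 \<subseteq> {col}"
  proof clarify
    fix e assume "e \<in> nsets (b ` {..<r}) 2"
    then obtain i j where ij: "e = {b i, b j}" "i < r" "j < r" "b i \<noteq> b j"
      by (auto elim!: nsets2_E)
    \<comment> \<open>The flank edge between the two chosen small intervals, on which the block
      number is already known.\<close>
    let ?u = "(2 * i + 1, A i, j, A j)" and ?v = "(2 * j + 1, A j, i, A i)"
    have "{?u, ?v} \<in> ?E"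
      unfolding interleaved_edges_def flank_edges_def using ij A by blast
    then have "c' (g ` {?u, ?v}) = col" by (rule ge)
    moreover have "blk (g ?u) = b i" "blk (g ?v) = b j"
      using ij A by (auto intro!: b simp: S_def)
    ultimately show "\<chi> e = col" using ij by (simp add: c'_def)
  qed
  moreover have "b ` {..<r} \<in> nsets {..<R} r"
    using b_less b_inj by (auto simp: nsets_def card_image)
  ultimately show False using \<chi>(2) col unfolding monochromatic_def by blast
qed

section \<open>Iteration\<close>

lemma ordered_arrows_mono:
  assumes "ordered_arrows M V E q" "M \<le> N"
  shows "ordered_arrows N V E q"
  unfolding ordered_arrows_def
proof
  have sub: "nsets {..<M} 2 \<subseteq> nsets {..<N} 2" using assms(2) by (intro nsets_mono) auto
  fix c :: "nat set \<Rightarrow> nat" assume "c \<in> nsets {..<N} 2 \<rightarrow> {..<q}"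
  then have "c \<in> nsets {..<M} 2 \<rightarrow> {..<q}" using sub by blast
  then obtain i where i: "i < q" "contains_copy {..<M} {e \<in> nsets {..<M} 2. c e = i} V E"
    using assms(1) unfolding ordered_arrows_def by blast
  from i(2) obtain f where f: "f ` V \<subseteq> {..<M}" "inj_on f V" "mono_on V f"
      "\<forall>e\<in>E. f ` e \<in> {e \<in> nsets {..<M} 2. c e = i}"
    unfolding contains_copy_def by (elim exE conjE)
  have "f ` V \<subseteq> {..<N}" using f(1) assms(2) by auto
  moreover have "\<forall>e\<in>E. f ` e \<in> {e \<in> nsets {..<N} 2. c e = i}" using f(4) sub by auto
  ultimately have "contains_copy {..<N} {e \<in> nsets {..<N} 2. c e = i} V E"
    unfolding contains_copy_def using f by blast
  then show "\<exists>i<q. contains_copy {..<N} {e \<in> nsets {..<N} 2. c e = i} V E"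
    using i(1) by blast
qed

lemma ordered_Ramsey_gt:
  assumes "ordered_graph V E" "q \<ge> 1" "\<not> ordered_arrows N V E q"
  shows "N < ordered_Ramsey V E q"
proof (rule ccontr)
  have "ordered_arrows (ordered_Ramsey V E q) V E q"
    unfolding ordered_Ramsey_def using ex_ordered_arrows[OF assms(1,2)] by (metis LeastI)
  moreover assume "\<not> N < ordered_Ramsey V E q"
  ultimately show False using assms(3) ordered_arrows_mono by (metis not_less)
qed

text \<open>Step \<open>j\<close> uses \<open>R = s ^ j\<close>, so that
  \<open>R\<^sup>2 = r ^ j\<close> keeps pace with the growth of the copies. The flanks then only
  raise the factor \<open>2 + r * k\<close> by \<open>r\<close> per step, while the number of
  coloured vertices gains a factor \<open>s ^ j\<close>.\<close>

lemma ex_ordered_matching_not_arrows: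
  fixes r s K :: nat
  assumes r: "r \<ge> 2" "r = s\<^sup>2"
    and clique: "\<And>j. j < K \<Longrightarrow> 2 * (s ^ j) ^ r < 2 ^ (r choose 2)"
    and "k \<le> K"
  shows "\<exists>(V :: nat set) E. ordered_matching V E \<and> (r - 1) ^ k * 2 \<le> card V \<and>
    card V \<le> r ^ k * (2 + r * k) \<and> \<not> ordered_arrows (s ^ (\<Sum>j<k. j)) V E 2"
  using \<open>k \<le> K\<close>
proof (induction k)
  case 0
  \<comment> \<open>The empty sum leaves one coloured vertex, on which a single edge does not
    fit.\<close>
  have "ordered_matching {0, 1} {{0, 1 :: nat}}"
    by (simp add: ordered_matching_def ordered_graph_def)
  moreover have "\<not> contains_copy {..<1::nat} F {0, 1 :: nat} E" for F E
    by (auto simp: contains_copy_def)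
  then have "\<not> ordered_arrows (s ^ (\<Sum>j<0. j)) {0, 1 :: nat} {{0, 1}} 2"
    unfolding ordered_arrows_def by (auto intro!: bexI[of _ "\<lambda>_. 0"] simp: lessThan_empty_iff)
  ultimately show ?case by (intro exI[of _ "{0, 1}"] exI[of _ "{{0, 1}}"]) auto
next
  case (Suc k)
  then obtain V :: "nat set" and E where V: "ordered_matching V E" "(r - 1) ^ k * 2 \<le> card V"
    "card V \<le> r ^ k * (2 + r * k)" "\<not> ordered_arrows (s ^ (\<Sum>j<k. j)) V E 2"
    by auto
  have s: "s > 0" using r by (cases s) auto
  have fin: "finite V" using V(1) by (simp add: ordered_matching_def ordered_graph_def)
  obtain \<chi> where \<chi>: "\<chi> \<in> nsets {..<s ^ k} 2 \<rightarrow> {..<2}"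
    "\<forall>i<2. \<not> monochromatic {..<s ^ k} r 2 \<chi> (i::nat)"
    using ex_colouring_no_monochromatic[OF clique[of k]] Suc.prems by auto
  let ?V = "interleaved_vertices r (s ^ k) V" and ?E = "interleaved_edges r (s ^ k) E"
  have "\<not> ordered_arrows (s ^ k * s ^ (\<Sum>j<k. j)) ?V ?E 2"
    using s r V by (intro not_ordered_arrows_interleaved[OF \<chi>]) auto
  then have na: "\<not> ordered_arrows (s ^ (\<Sum>j<Suc k. j)) ?V ?E 2"
    by (simp add: power_add mult.commute)
  obtain V' :: "nat set" and E' where V': "ordered_matching V' E'" "card V' = card ?V"
    "\<And>N q. ordered_arrows N V' E' q \<Longrightarrow> ordered_arrows N ?V ?E q"
    using ordered_matching_to_nat[OF ordered_matching_interleaved[OF V(1)]] by blast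
  have "(r - 1) ^ Suc k * 2 \<le> (r - 1) * card V" using V(2) by simp
  also have "\<dots> \<le> card V'" using card_interleaved_ge[OF fin] V'(2) by metis
  finally have lower: "(r - 1) ^ Suc k * 2 \<le> card V'" .
  have "card V' \<le> r * (card V + r * (s ^ k)\<^sup>2)" using card_interleaved_le[OF fin] V'(2) by metis
  also have "(s ^ k)\<^sup>2 = r ^ k" using r(2) by (metis power_commutes power_mult mult.commute)
  also have "r * (card V + r * r ^ k) \<le> r * (r ^ k * (2 + r * k) + r * r ^ k)"
    using V(3) by (intro mult_le_mono2 add_le_mono1)
  also have "\<dots> = r ^ Suc k * (2 + r * Suc k)" by (simp add: algebra_simps)
  finally show ?case using V' lower na by blast
qed

section \<open>Choice of parameters and numerical estimates\<close>

text \<open>To leading order the left side is \<open>(2 * h)\<^sup>2 / (5 * 2 * p)\<close>, that is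
  \<open>0.4 * h\<^sup>2 / p\<close>, against \<open>0.5 * h\<^sup>2 / p\<close> on the right. The
  constant 5 in place of 4 thus leaves room for the lower-order terms; \<open>52 / 25\<close> comes
  from \<open>4 * p \<le> 4 / 50 * h\<close>.\<close>

lemma exponent_bound:
  fixes p h L M :: real
  assumes "8 \<le> p" "50 * p \<le> h" "0 \<le> L" "L \<le> 2 * h + 4 * p" "2 * p - 1 \<le> M"
  shows "L * (L / (5 * M)) \<le> h * (h - p) / (2 * p)"
proof -
  have "L * L \<le> (52 / 25 * h) * (52 / 25 * h)"
    using assms by (intro mult_mono) auto
  also have "\<dots> \<le> 4.4 * h\<^sup>2" by (simp add: power2_eq_square)
  finally have "L * L / (5 * M) \<le> 4.4 * h\<^sup>2 / (5 * (2 * p - 1))"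
    using assms by (intro frac_le) auto
  also have "\<dots> \<le> 0.49 * h\<^sup>2 / p"
  proof -
    have "4.4 * p \<le> 0.49 * (5 * (2 * p - 1))" using assms by simp
    then have "4.4 * p * h\<^sup>2 \<le> 0.49 * (5 * (2 * p - 1)) * h\<^sup>2"
      by (intro mult_right_mono) auto
    then show ?thesis using assms by (simp add: divide_simps mult_ac)
  qed
  also have "\<dots> \<le> h * (h - p) / (2 * p)"
  proof -
    have "h * (49 / 50 * h) \<le> h * (h - p)" using assms by (intro mult_left_mono) auto
    then show ?thesis using assms by (simp add: divide_simps power2_eq_square)
  qed
  finally show ?thesis by simp
qed

theorem theorem5:
  shows "\<forall>n0::nat. \<exists>n\<ge>n0. \<exists>(V :: nat set) (E :: nat set set).
    ordered_matching V E \<and> card V = n \<and>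
    real (ordered_Ramsey V E 2) \<ge> real n powr (log 2 (real n) / (5 * log 2 (log 2 (real n))))"
proof
  fix n0 :: nat
  txt \<open>With \<open>r = 4\<^bsup>p\<^esup>\<close> and \<open>p\<close> a power of two, the number \<open>K = r / log r\<close> of steps is an integer.\<close>
  define q where "q = n0 + 3"
  define p :: nat where "p = 2 ^ q"
  \<comment> \<open>Since \<open>log r = 2 * p\<close>, the number of steps satisfies
    \<open>p * K = h = r / 2\<close>, and \<open>s = 2 ^ p\<close> is the square root of
    \<open>r\<close>. The summand 3 in \<open>q\<close> ensures \<open>8 \<le> p\<close>.\<close>
  define h :: nat where "h = 2 ^ (2 * p - 1)"
  define K :: nat where "K = 2 ^ (2 * p - 1 - q)"
  define r :: nat where "r = 2 * h"
  define s :: nat where "s = 2 ^ p"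
  have "q < p" unfolding p_def by simp
  have p8: "8 \<le> p" unfolding p_def q_def by (simp add: power_add)
  have pK: "p * K = h"
  proof -
    have "p * K = 2 ^ (q + (2 * p - 1 - q))" unfolding K_def power_add by (simp add: p_def)
    also have "q + (2 * p - 1 - q) = 2 * p - 1" using \<open>q < p\<close> by simp
    finally show ?thesis unfolding h_def .
  qed
  have rp: "r = 2 ^ (2 * p)" unfolding r_def h_def using p8 by (simp flip: power_Suc)
  have rs: "r = s\<^sup>2" by (simp add: rp s_def mult.commute flip: power_mult)
  have h50: "50 * p \<le> h"
  proof -
    have "50 * p \<le> 2 ^ (p - 1) * 2 ^ p"
    proof (rule mult_le_mono)
      have "(2::nat) ^ 7 \<le> 2 ^ (p - 1)" using p8 by (intro power_increasing) auto
      then show "50 \<le> (2::nat) ^ (p - 1)" by simp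
    qed (simp add: less_imp_le)
    also have "\<dots> = h" unfolding h_def power_add[symmetric] using p8
      by (intro arg_cong[of _ _ "\<lambda>m. 2 ^ m"]) simp
    finally show ?thesis .
  qed
  have K1: "1 \<le> K" unfolding K_def by simp
  \<comment> \<open>Comparing exponents, \<open>p * j * r + 1\<close> must stay below
    \<open>r choose 2\<close>, which is \<open>2 * h\<^sup>2 - h\<close>. From
    \<open>j + 1 \<le> K\<close> follows \<open>p * j \<le> h - p\<close>, which leaves the margin
    \<open>2 * p * h\<close>; this is what limits the number of steps to about
    \<open>r / log r\<close>.\<close>
  have clique: "2 * (s ^ j) ^ r < 2 ^ (r choose 2)" if "j < K" for j
  proof -
    have "p * (j + 1) \<le> h" using that pK by (metis Suc_eq_plus1 Suc_leI mult_le_mono2)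
    then have "(p * j + p) * (2 * h) \<le> h * (2 * h)" by (intro mult_le_mono1) simp
    then have "p * j * r + 2 * (p * h) \<le> 2 * (h * h)" by (simp add: r_def algebra_simps)
    moreover have "8 * h \<le> p * h" using p8 by simp
    moreover have "r choose 2 = 2 * (h * h) - h"
      by (simp add: choose_two r_def diff_mult_distrib2)
    ultimately have "Suc (p * j * r) < r choose 2" using h50 p8 by linarith
    then have "(2::nat) ^ Suc (p * j * r) < 2 ^ (r choose 2)" by (intro power_strict_increasing) auto
    then show ?thesis by (simp add: s_def power_mult)
  qed
  have r2: "2 \<le> r" using h50 p8 by (simp add: r_def)
  obtain V :: "nat set" and E where VE: "ordered_matching V E" and lower: "(r - 1) ^ K * 2 \<le> card V"
    and upper: "card V \<le> r ^ K * (2 + r * K)" and na: "\<not> ordered_arrows (s ^ (\<Sum>j<K. j)) V E 2"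
    using ex_ordered_matching_not_arrows[OF r2 rs clique order_refl] by blast
  define n where "n = card V"
  \<comment> \<open>About half of the true \<open>log n\<close> is given away here, which costs only
    an additive constant in \<open>log (log n)\<close>.\<close>
  have "2 ^ h \<le> n"
  proof -
    have "(2::nat) ^ h \<le> 2 ^ ((2 * p - 1) * K)"
      unfolding pK[symmetric] using p8 by (intro power_increasing mult_le_mono1) auto
    also have "\<dots> = h ^ K" by (simp add: h_def power_mult)
    also have "\<dots> \<le> (r - 1) ^ K" unfolding r_def using h50 p8 by (intro power_mono) auto
    finally show ?thesis using lower unfolding n_def by linarith
  qed
  \<comment> \<open>The factor \<open>2 + r * K\<close> is absorbed into
    \<open>r\<^sup>2 = 2 ^ (4 * p)\<close>.\<close>
  have "n \<le> 2 ^ (2 * h + 4 * p)"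
  proof -
    have "K \<le> h" using pK p8 by (metis mult_le_mono1 mult_1 order_trans one_le_numeral)
    then have "2 + r * K \<le> 2 + r * h" by simp
    also have "\<dots> \<le> r * r" using h50 p8 by (simp add: r_def)
    finally have "n \<le> r ^ K * (r * r)" using upper mult_le_mono2 order_trans unfolding n_def by blast
    also have "\<dots> = r ^ (K + 2)" by (simp add: power_add power2_eq_square)
    also have "\<dots> = 2 ^ (2 * p * (K + 2))" by (simp only: rp power_mult)
    also have "2 * p * (K + 2) = 2 * h + 4 * p" by (simp add: pK[symmetric] algebra_simps)
    finally show ?thesis .
  qed
  define L where "L = log 2 (real n)"
  have "(0::nat) < 2 ^ h" by simp
  then have n_pos: "0 < real n" using \<open>2 ^ h \<le> n\<close> by linarith
  have "real h = log 2 (2 ^ h)" by simp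
  also have "\<dots> \<le> L" unfolding L_def
    using \<open>2 ^ h \<le> n\<close> n_pos by (subst log_le_cancel_iff) auto
  finally have "h \<le> L" .
  have "L \<le> log 2 (2 ^ (2 * h + 4 * p))" unfolding L_def
    using \<open>n \<le> _\<close> n_pos by (subst log_le_cancel_iff) auto
  then have L_le: "L \<le> 2 * h + 4 * p" by simp
  have "2 * real p - 1 = log 2 (real h)" unfolding h_def using p8 by (simp add: of_nat_diff)
  also have "\<dots> \<le> log 2 L" using \<open>h \<le> L\<close> h50 p8 by (subst log_le_cancel_iff) auto
  finally have M: "2 * real p - 1 \<le> log 2 L" .
  have "real n powr (L / (5 * log 2 L)) = 2 powr (L * (L / (5 * log 2 L)))"
  proof -
    have "real n = 2 powr L" unfolding L_def using n_pos by simp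
    then show ?thesis by (simp only: powr_powr)
  qed
  also have "\<dots> \<le> 2 powr (real h * (real h - real p) / (2 * real p))"
    using exponent_bound[of "real p" "real h" L "log 2 L"] p8 h50 \<open>h \<le> L\<close> L_le M by simp
  \<comment> \<open>With \<open>h = p * K\<close> the exponent is
    \<open>p * K * (K - 1) / 2\<close>, the logarithm of the number of vertices coloured after
    \<open>K\<close> steps.\<close>
  also have "\<dots> = real (s ^ (\<Sum>j<K. j))"
  proof -
    have "(\<Sum>j<K. real j) = real K * (real K - 1) / 2" by (induction K) (auto simp: field_simps)
    moreover have "real h * (real h - real p) / (2 * real p)
        = real p * (real K * (real K - 1) / 2)"
      using p8 by (simp add: field_simps flip: pK)
    ultimately have "real h * (real h - real p) / (2 * real p) = real (p * (\<Sum>j<K. j))"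
      by (simp only: of_nat_mult of_nat_sum)
    moreover have "2 powr real (p * (\<Sum>j<K. j)) = 2 ^ (p * (\<Sum>j<K. j))"
      by (rule powr_realpow) simp
    ultimately show ?thesis by (simp only: s_def power_mult of_nat_power of_nat_numeral)
  qed
  also have "\<dots> \<le> real (ordered_Ramsey V E 2)"
    using ordered_Ramsey_gt[OF _ _ na] VE by (simp add: ordered_matching_def less_imp_le)
  finally have "real n powr (L / (5 * log 2 L)) \<le> real (ordered_Ramsey V E 2)" .
  moreover have "n0 \<le> n"
  proof -
    have "n0 \<le> p" using \<open>q < p\<close> by (simp add: q_def)
    also have "\<dots> \<le> h" using h50 by simp
    also have "\<dots> \<le> 2 ^ h" by (simp add: less_imp_le)
    finally show ?thesis using \<open>2 ^ h \<le> n\<close> by simp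
  qed
  ultimately show "\<exists>n\<ge>n0. \<exists>(V :: nat set) (E :: nat set set).
    ordered_matching V E \<and> card V = n \<and>
    real (ordered_Ramsey V E 2) \<ge> real n powr (log 2 (real n) / (5 * log 2 (log 2 (real n))))"
    using VE unfolding n_def L_def by blast
qed

end
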